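(* Let $N\ge 2$, $1 \le p \le N$, and let $\Omega \subsetneq \mathbb{R}^N$ be an open set such that $\theta^*_{\Omega, r_0}(t)>0$ for some $r_0 > 0$ and $t\ge 0$. Then there exists an (explicit) parameter $0 < \gamma_0 < 1$, depending only on $N$, $p$, $\theta^*_{\Omega, r_0}(t)$, $t$ and $r_0/r_\Omega$, such that, if we set \[ \mathcal{C}=\begin{cases} 6\,\sqrt{N},& \text{if}\ 0<\gamma<\gamma_0,\\[4pt] 6\,\sqrt{N}\,\left(\dfrac{2\,C_{N,p,\gamma}}{\gamma_0\,\sigma_{N,p}}\right)^{\frac{1}{p}},& \text{if}\ \gamma_0\le \gamma<1, \end{cases} \] then \[ r_\Omega\le R_{p,\gamma}(\Omega) \le \mathcal{C}\,r_{\Omega}, \qquad \text{for every}\ 0<\gamma <1. \]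
   Context: $B_r(x)$ is the open Euclidean ball in $\mathbb{R}^N$ of center $x$ and radius $r$; $|\cdot|$ is Lebesgue measure; $C^\infty_0(E)$ is the space of smooth functions with compact support in $E$. Suprema of sets of positive numbers are taken in $[0,+\infty]$. Inradius: $r_\Omega=\sup\{r>0 : \text{there exists a ball } B_r(x_0)\subseteq\Omega\}$. Measure density index: for $r_0>0$, $t\ge 0$, \[ \theta^*_{\Omega,r_0}(t)=\inf\left\{\left(\frac{r_0}{r}\right)^t\,\frac{|B_r(x)\setminus \Omega|}{|B_r(x)|} : x\in \partial \Omega,\ 0 < r \le r_0\right\}. \] Relative $p$-capacity: for $E\subseteq \mathbb{R}^N$ open and $\Sigma\subseteq E$ compact, \[ \mathrm{cap}_p(\Sigma;E)=\inf\left\{\int_E |\nabla \varphi|^p\,dx : \varphi\in C^\infty_0(E),\ \varphi \ge 1 \text{ on } \Sigma\right\}. \] Capacitary inradius: for $0<\gamma<1$, \[ R_{p,\gamma}(\Omega)=\sup\Big\{r>0 : \exists x_0\in\mathbb{R}^N \text{ such that } \mathrm{cap}_p\big(\overline{B_r(x_0)}\setminus\Omega;B_{2r}(x_0)\big)\le \gamma\,\mathrm{cap}_p\big(\overline{B_r(x_0)};B_{2r}(x_0)\big)\Big\}. \] Sharp Poincaré constant: $\lambda_p(\Omega)=\inf\{\int_\Omega |\nabla \varphi|^p\,dx : \varphi\in C^\infty_0(\Omega),\ \|\varphi\|_{L^p(\Omega)}=1\}$. The constants $\sigma_{N,p}>0$ (depending only on $N,p$) and $C_{N,p,\gamma}>0$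 (depending only on $N,p,\gamma$) are those of the following known two-sided estimate, which holds for every $1\le p\le N$, every $0<\gamma<1$ and every open set $\Omega\subseteq\mathbb{R}^N$: \[ \sigma_{N,p}\,\gamma\,\left(\frac{1}{R_{p,\gamma}(\Omega)}\right)^p\le \lambda_p(\Omega)\le C_{N,p,\gamma}\,\left(\frac{1}{R_{p,\gamma}(\Omega)}\right)^p . \] *)

theory Defs
  imports "HOL-Analysis.Analysis"
begin

primrec C_k :: "nat \<Rightarrow> ('a::euclidean_space \<Rightarrow> real) \<Rightarrow> bool" where
  "C_k 0 f \<longleftrightarrow> continuous_on UNIV f"
| "C_k (Suc k) f \<longleftrightarrow>
     (\<forall>x. f differentiable (at x)) \<and>
     (\<forall>b\<in>Basis. C_k k (\<lambda>x. frechet_derivative f (at x) b))"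

definition smooth :: "('a::euclidean_space \<Rightarrow> real) \<Rightarrow> bool" where
  "smooth f \<longleftrightarrow> (\<forall>k. C_k k f)"

text \<open>Test functions on an open set \<open>E\<close> are represented by their extension by zero
  to the whole space.\<close>

definition test_functions :: "'a::euclidean_space set \<Rightarrow> ('a \<Rightarrow> real) set" where
  "test_functions E =
     {\<phi>. smooth \<phi> \<and> compact (closure {x. \<phi> x \<noteq> 0}) \<and> closure {x. \<phi> x \<noteq> 0} \<subseteq> E}"

definition gradient :: "('a::euclidean_space \<Rightarrow> real) \<Rightarrow> 'a \<Rightarrow> 'a" where
  "gradient f x = (\<Sum>b\<in>Basis. frechet_derivative f (at x) b *\<^sub>R b)"

text \<open>Real powers on \<open>[0, \<infinity>]\<close>; only meant for exponents \<open>a > 0\<close>,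
  where \<open>0\<close> and \<open>\<infinity>\<close> are fixed points.\<close>

definition enn_powr :: "ennreal \<Rightarrow> real \<Rightarrow> ennreal" where
  "enn_powr x a = (if x = \<infinity> then \<infinity> else ennreal (enn2real x powr a))"

definition Lp_norm :: "real \<Rightarrow> 'a::euclidean_space set \<Rightarrow> ('a \<Rightarrow> real) \<Rightarrow> ennreal" where
  "Lp_norm p E f = enn_powr (\<integral>\<^sup>+x\<in>E. ennreal (\<bar>f x\<bar> powr p) \<partial>lborel) (1 / p)"

definition dirichlet_energy :: "real \<Rightarrow> 'a::euclidean_space set \<Rightarrow> ('a \<Rightarrow> real) \<Rightarrow> ennreal" where
  "dirichlet_energy p E f = (\<integral>\<^sup>+x\<in>E. ennreal (norm (gradient f x) powr p) \<partial>lborel)"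

definition inradius :: "'a::euclidean_space set \<Rightarrow> ennreal" where
  "inradius \<Omega> = Sup {ennreal r | r. r > 0 \<and> (\<exists>x0. ball x0 r \<subseteq> \<Omega>)}"

text \<open>All suprema and infima are taken in \<open>[0, \<infinity>]\<close>, so the supremum of the empty set
  is \<open>0\<close> and its infimum is \<open>\<infinity>\<close>; the latter is the value of the index
  below when \<open>\<Omega>\<close> is empty.\<close>

definition measure_density_index ::
    "'a::euclidean_space set \<Rightarrow> real \<Rightarrow> real \<Rightarrow> ennreal" where
  "measure_density_index \<Omega> r0 t =
     Inf {ennreal ((r0 / r) powr t) * (emeasure lborel (ball x r - \<Omega>) / emeasure lborel (ball x r))
          | x r. x \<in> frontier \<Omega> \<and> 0 < r \<and> r \<le> r0}"

definition rel_capacity ::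
    "real \<Rightarrow> 'a::euclidean_space set \<Rightarrow> 'a set \<Rightarrow> ennreal" where
  "rel_capacity p \<Sigma> E =
     Inf {dirichlet_energy p E \<phi> | \<phi>. \<phi> \<in> test_functions E \<and> (\<forall>x\<in>\<Sigma>. \<phi> x \<ge> 1)}"

definition capacitary_inradius :: "real \<Rightarrow> real \<Rightarrow> 'a::euclidean_space set \<Rightarrow> ennreal" where
  "capacitary_inradius p \<gamma> \<Omega> =
     Sup {ennreal r | r. r > 0 \<and>
       (\<exists>x0. rel_capacity p (closure (ball x0 r) - \<Omega>) (ball x0 (2 * r))
              \<le> ennreal \<gamma> * rel_capacity p (closure (ball x0 r)) (ball x0 (2 * r)))}"

definition poincare_constant :: "real \<Rightarrow> 'a::euclidean_space set \<Rightarrow> ennreal" where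
  "poincare_constant p \<Omega> =
     Inf {dirichlet_energy p \<Omega> \<phi> | \<phi>. \<phi> \<in> test_functions \<Omega> \<and> Lp_norm p \<Omega> \<phi> = 1}"

text \<open>\<open>\<sigma> p\<close> and \<open>C p \<gamma>\<close> are admissible constants, in the dimension of
  \<open>'a\<close>, in the two-sided estimate of the Poincare constant by the capacitary inradius.
  In \<open>ennreal\<close>, \<open>1 / 0 = \<infinity>\<close> and \<open>1 / \<infinity> = 0\<close>.\<close>

definition two_sided_estimate_constants ::
    "'a::euclidean_space itself \<Rightarrow> (real \<Rightarrow> real) \<Rightarrow> (real \<Rightarrow> real \<Rightarrow> real) \<Rightarrow> bool" where
  "two_sided_estimate_constants (_ :: 'a itself) \<sigma> C \<longleftrightarrow>
     (\<forall>p. 1 \<le> p \<and> p \<le> real DIM('a) \<longrightarrow>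
        \<sigma> p > 0 \<and>
        (\<forall>\<gamma>. 0 < \<gamma> \<and> \<gamma> < 1 \<longrightarrow>
           C p \<gamma> > 0 \<and>
           (\<forall>\<Omega>::'a set. open \<Omega> \<longrightarrow>
              ennreal (\<sigma> p * \<gamma>) * enn_powr (1 / capacitary_inradius p \<gamma> \<Omega>) p
                \<le> poincare_constant p \<Omega> \<and>
              poincare_constant p \<Omega>
                \<le> ennreal (C p \<gamma>) * enn_powr (1 / capacitary_inradius p \<gamma> \<Omega>) p)))"

end

theory Submission
  imports Defs
begin

text \<open>
  The inequality \<open>r\<^sub>\<Omega> \<le> R\<^sub>p\<^sub>,\<^sub>\<gamma>(\<Omega>)\<close> holds because a closed ball contained in \<open>\<Omega>\<close> leaves nothing outside
  \<open>\<Omega>\<close>, and the empty set has capacity zero (\<open>inradius_le_capacitary_inradius\<close>).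

  For the upper bound with small \<open>\<gamma>\<close>, capacity is compared with volume. A test function on
  \<open>B\<^sub>2\<^sub>r(x\<^sub>0)\<close> that is at least \<open>1\<close> at a point of the concentric ball of radius \<open>r\<close> vanishes after a
  displacement of length \<open>3r\<close>, so that the fundamental theorem of calculus along this segment
  and Tonelli's theorem give \<open>|\<Sigma>| \<le> (3r)\<^sup>p cap\<^sub>p(\<Sigma>; B\<^sub>2\<^sub>r)\<close> (\<open>emeasure_le_rel_capacity\<close>), while scaling
  gives \<open>cap\<^sub>p(B\<^sub>r; B\<^sub>2\<^sub>r) = O(r\<^sup>N\<^sup>-\<^sup>p)\<close> for the closed ball \<open>B\<^sub>r\<close> (\<open>rel_capacity_cball_le\<close>). Hence a ball
  that is admissible for \<open>R\<^sub>p\<^sub>,\<^sub>\<gamma>\<close> satisfies \<open>|B\<^sub>r - \<Omega>| = O(\<gamma> |B\<^sub>r|)\<close>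
  (\<open>emeasure_le_of_small_capacity\<close>).

  On the other hand the density of the complement at boundary points forces \<open>|B\<^sub>r - \<Omega>| \<ge> c |B\<^sub>r|\<close>
  as soon as \<open>r > 6 r\<^sub>\<Omega>\<close> (\<open>measure_ball_diff_ge\<close>): if \<open>\<rho>\<close> is slightly larger than \<open>r\<^sub>\<Omega>\<close>, no ball of
  radius \<open>\<rho>\<close> is contained in \<open>\<Omega>\<close>, so each of them either misses \<open>\<Omega>\<close> or meets its boundary, and in
  both cases the complement of \<open>\<Omega>\<close> fills a definite fraction of the ball of radius \<open>2\<rho>\<close>. Averaging
  over the centres of these balls gives the bound on \<open>B\<^sub>r\<close>. The constant \<open>c\<close> depends only on \<open>N\<close>, the
  density index, \<open>t\<close> and \<open>r\<^sub>0 / r\<^sub>\<Omega>\<close>, so the two bounds are incompatible for \<open>\<gamma>\<close> below a threshold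
  \<open>\<gamma>\<^sub>0\<close> (\<open>capacity_threshold\<close>) depending on these quantities and \<open>p\<close>, and there
  \<open>R\<^sub>p\<^sub>,\<^sub>\<gamma>(\<Omega>) \<le> 6 r\<^sub>\<Omega>\<close>.

  For \<open>\<gamma> \<ge> \<gamma>\<^sub>0\<close> the two-sided estimate of the Poincare constant, used from above with \<open>\<gamma>\<close> and from
  below with \<open>\<gamma>\<^sub>0 / 2\<close>, bounds \<open>R\<^sub>p\<^sub>,\<^sub>\<gamma>\<close> by a multiple of \<open>R\<^sub>p\<^sub>,\<^sub>\<gamma>\<^sub>0\<^sub>/\<^sub>2\<close> (\<open>capacitary_inradius_comparison\<close>).
  Applied to the empty set, the same estimate shows that the unit ball has finite capacity and that
  \<open>R\<^sub>p\<^sub>,\<^sub>\<gamma>(\<emptyset>) = 0\<close>.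
\<close>

section \<open>Gradients of smooth functions\<close>

lemma smooth_differentiable: "smooth f \<Longrightarrow> f differentiable (at x)"
  unfolding smooth_def using C_k.simps(2) by blast

lemma smooth_continuous_on_partial:
  "smooth f \<Longrightarrow> b \<in> Basis \<Longrightarrow> continuous_on UNIV (\<lambda>x. frechet_derivative f (at x) b)"
  unfolding smooth_def using C_k.simps by (metis One_nat_def)

lemma continuous_on_gradient: "smooth f \<Longrightarrow> continuous_on UNIV (gradient f)"
  unfolding gradient_def by (intro continuous_intros smooth_continuous_on_partial) auto

lemma borel_measurable_gradient: "smooth f \<Longrightarrow> gradient f \<in> borel_measurable borel"
  by (intro borel_measurable_continuous_onI continuous_on_gradient)

lemma frechet_derivative_eq_inner_gradient:
  assumes "f differentiable (at x)"
  shows "frechet_derivative f (at x) v = gradient f x \<bullet> v"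
proof -
  have lin: "linear (frechet_derivative f (at x))"
    using assms by (simp add: frechet_derivative_works has_derivative_linear)
  have "frechet_derivative f (at x) v = frechet_derivative f (at x) (\<Sum>b\<in>Basis. (v \<bullet> b) *\<^sub>R b)"
    by (simp add: euclidean_representation)
  also have "\<dots> = (\<Sum>b\<in>Basis. (v \<bullet> b) * frechet_derivative f (at x) b)"
    by (simp add: linear_sum[OF lin] linear_scale[OF lin] o_def)
  also have "\<dots> = gradient f x \<bullet> v"
    unfolding gradient_def by (simp add: inner_sum_left inner_commute[of v] mult.commute)
  finally show ?thesis .
qed

lemma has_derivative_gradient:
  assumes "f differentiable (at x)"
  shows "(f has_derivative (\<lambda>v. gradient f x \<bullet> v)) (at x)"
  using assms frechet_derivative_eq_inner_gradient[OF assms] frechet_derivative_works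
  by (metis (no_types, lifting) ext)

lemma gradient_eq_0_outside_closure:
  assumes "x \<notin> closure {x. f x \<noteq> 0}"
  shows "gradient f x = 0"
proof -
  have "frechet_derivative f (at x) = (\<lambda>v. 0)"
  proof (rule frechet_derivative_at[symmetric])
    show "(f has_derivative (\<lambda>v. 0)) (at x)"
    proof (rule has_derivative_transform_within_open[where s = "- closure {x. f x \<noteq> 0}"])
      show "((\<lambda>x. 0) has_derivative (\<lambda>v. 0)) (at x)" by simp
      show "open (- closure {x. f x \<noteq> 0})" by (intro open_Compl closed_closure)
      show "0 = f y" if "y \<in> - closure {x. f x \<noteq> 0}" for y
        using that closure_subset[of "{x. f x \<noteq> 0}"] by auto
    qed (use assms in auto)
  qed
  then show ?thesis by (simp add: gradient_def)
qed

text \<open>The energy of a test function can be computed over the whole space, which makes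
  translations and dilations of the integrand available.\<close>

lemma dirichlet_energy_test_function:
  assumes "\<phi> \<in> test_functions E"
  shows "dirichlet_energy p E \<phi> = (\<integral>\<^sup>+x. ennreal (norm (gradient \<phi> x) powr p) \<partial>lborel)"
  unfolding dirichlet_energy_def
proof (rule nn_integral_cong)
  fix x
  show "ennreal (norm (gradient \<phi> x) powr p) * indicator E x = ennreal (norm (gradient \<phi> x) powr p)"
    using assms gradient_eq_0_outside_closure[of x \<phi>]
    by (cases "x \<in> E") (auto simp: test_functions_def subset_iff)
qed

section \<open>Capacity controls volume\<close>

text \<open>This tangent line replaces Jensen's inequality: bounding \<open>u\<^sup>p\<close> below by an affine function
  of \<open>u\<close> turns a lower bound on \<open>\<integral> u\<close> over a unit interval into one on \<open>\<integral> u\<^sup>p\<close>.\<close>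

lemma powr_ge_tangent_at_one:
  fixes u p :: real
  assumes "0 \<le> u" "1 \<le> p"
  shows "1 + p * (u - 1) \<le> u powr p"
proof (cases "u = 0")
  case True
  then show ?thesis using assms by simp
next
  case False
  have "u powr p - 1 powr p \<ge> p * (u - 1)"
  proof (rule convex_on_imp_above_tangent[where A = "{0<..}"])
    show "((\<lambda>x. x powr p) has_real_derivative p) (at 1 within {0<..})"
      by (auto intro!: derivative_eq_intros)
  qed (use False assms powr_convex in \<open>auto simp: interior_open\<close>)
  then show ?thesis by simp
qed

text \<open>Along the segment from \<open>x\<close> to \<open>x + v\<close> the function drops from at least \<open>1\<close> to \<open>0\<close>, so the mean
  of \<open>|v| |\<nabla>\<phi>|\<close> over the segment is at least \<open>1\<close>; convexity passes this to the \<open>p\<close>-th power.\<close>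

lemma one_le_segment_energy:
  fixes \<phi> :: "'a::euclidean_space \<Rightarrow> real"
  assumes \<phi>: "smooth \<phi>" and p: "1 \<le> p" and x: "1 \<le> \<phi> x" and v: "\<phi> (x + v) = 0"
  shows "1 \<le> (\<integral>\<^sup>+s\<in>{0..1}. ennreal ((norm v * norm (gradient \<phi> (x + s *\<^sub>R v))) powr p) \<partial>lborel)"
proof -
  define u where "u s = norm v * norm (gradient \<phi> (x + s *\<^sub>R v))" for s :: real
  define d where "d s = gradient \<phi> (x + s *\<^sub>R v) \<bullet> v" for s :: real
  have "(d has_integral \<phi> (x + 1 *\<^sub>R v) - \<phi> (x + 0 *\<^sub>R v)) {0..1}"
  proof (rule fundamental_theorem_of_calculus)
    fix s :: real assume "s \<in> {0..1}"
    have "((\<lambda>s. \<phi> (x + s *\<^sub>R v)) has_derivative (\<lambda>h. gradient \<phi> (x + s *\<^sub>R v) \<bullet> (h *\<^sub>R v))) (at s within {0..1})"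
      by (rule has_derivative_compose[OF _ has_derivative_gradient[OF smooth_differentiable[OF \<phi>]]])
        (auto intro!: derivative_eq_intros)
    then show "((\<lambda>s. \<phi> (x + s *\<^sub>R v)) has_vector_derivative d s) (at s within {0..1})"
      by (simp add: has_vector_derivative_def d_def)
  qed simp
  then have "(d has_integral - \<phi> x) {0..1}"
    using v by simp
  from has_integral_add[OF has_integral_const_real[of "1 - p" 0 1] has_integral_mult_right[OF this, of "- p"]]
  have tangent: "((\<lambda>s. 1 + p * (- d s - 1)) has_integral 1 + p * (\<phi> x - 1)) {0..1}"
    by (simp add: algebra_simps)
  have cont: "continuous_on {0..1} u"
    unfolding u_def
    by (intro continuous_intros continuous_on_compose2[OF continuous_on_gradient[OF \<phi>]]) auto
  have "continuous_on {0..1} (\<lambda>s. u s powr p)"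
    by (rule continuous_on_powr'[OF cont]) (use p in \<open>auto simp: u_def intro!: continuous_intros\<close>)
  then have u: "((\<lambda>s. u s powr p) has_integral integral {0..1} (\<lambda>s. u s powr p)) {0..1}"
    by (intro integrable_integral integrable_continuous_interval)
  have "1 \<le> 1 + p * (\<phi> x - 1)" using p x by simp
  also have "\<dots> \<le> integral {0..1} (\<lambda>s. u s powr p)"
  proof (rule has_integral_le[OF tangent u])
    fix s :: real
    have "- d s \<le> u s"
      unfolding d_def u_def using Cauchy_Schwarz_ineq2[of "gradient \<phi> (x + s *\<^sub>R v)" v]
      by (simp add: mult.commute)
    then have "1 + p * (- d s - 1) \<le> 1 + p * (u s - 1)" using p by simp
    also have "\<dots> \<le> u s powr p" by (rule powr_ge_tangent_at_one) (simp_all add: u_def p)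
    finally show "1 + p * (- d s - 1) \<le> u s powr p" .
  qed
  finally have "1 \<le> ennreal (integral {0..1} (\<lambda>s. u s powr p))" by simp
  also have "\<dots> = (\<integral>\<^sup>+s\<in>{0..1}. ennreal (u s powr p) \<partial>lborel)"
    by (rule nn_integral_has_integral_lebesgue'[OF _ u, symmetric]) simp
  finally show ?thesis
    unfolding u_def by simp
qed

lemma nn_integral_lborel_affine:
  fixes f :: "'a::euclidean_space \<Rightarrow> ennreal"
  assumes [measurable]: "f \<in> borel_measurable borel" and m: "0 < m"
  shows "(\<integral>\<^sup>+x. f x \<partial>lborel) = ennreal (m ^ DIM('a)) * (\<integral>\<^sup>+x. f (m *\<^sub>R x + c) \<partial>lborel)"
proof -
  have "(\<integral>\<^sup>+x. f x \<partial>lborel)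
      = (\<integral>\<^sup>+x. f x \<partial>density (distr lborel borel (\<lambda>x. c + m *\<^sub>R x)) (\<lambda>_. \<bar>m\<bar> ^ DIM('a)))"
    using lborel_affine[of m c] m by simp
  also have "\<dots> = ennreal (m ^ DIM('a)) * (\<integral>\<^sup>+x. f (m *\<^sub>R x + c) \<partial>lborel)"
    using m by (simp add: nn_integral_density nn_integral_distr nn_integral_cmult add.commute)
  finally show ?thesis .
qed

text \<open>A Poincare inequality with a translation in place of coordinates: the segment estimate
  is integrated over the starting points in \<open>S\<close>, and after exchanging the integrals each
  translate \<open>x + s v\<close> contributes the same energy.\<close>

lemma emeasure_le_dirichlet_energy:
  fixes \<phi> :: "'a::euclidean_space \<Rightarrow> real"
  assumes \<phi>: "\<phi> \<in> test_functions E" and p: "1 \<le> p"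
    and S[measurable]: "S \<in> sets borel"
    and one: "\<And>x. x \<in> S \<Longrightarrow> 1 \<le> \<phi> x" and exit: "\<And>x. x \<in> S \<Longrightarrow> x + v \<notin> E"
  shows "emeasure lborel S \<le> ennreal (norm v powr p) * dirichlet_energy p E \<phi>"
proof -
  have smooth: "smooth \<phi>" using \<phi> by (simp add: test_functions_def)
  note [measurable] = borel_measurable_gradient[OF smooth]
  have zero: "\<phi> x = 0" if "x \<notin> E" for x
    using \<phi> that closure_subset[of "{x. \<phi> x \<noteq> 0}"] by (auto simp: test_functions_def)
  define w where "w y = ennreal ((norm v * norm (gradient \<phi> y)) powr p)" for y
  have [measurable]: "w \<in> borel_measurable borel" unfolding w_def by measurable
  have "emeasure lborel S = (\<integral>\<^sup>+x. indicator S x \<partial>lborel)" by simp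
  also have "\<dots> \<le> (\<integral>\<^sup>+x. (\<integral>\<^sup>+s\<in>{0..1::real}. w (x + s *\<^sub>R v) \<partial>lborel) \<partial>lborel)"
  proof (rule nn_integral_mono)
    fix x
    show "indicator S x \<le> (\<integral>\<^sup>+s\<in>{0..1::real}. w (x + s *\<^sub>R v) \<partial>lborel)"
      using one_le_segment_energy[OF smooth p one zero[OF exit]]
      by (cases "x \<in> S") (auto simp: w_def)
  qed
  also have "\<dots> = (\<integral>\<^sup>+s. (\<integral>\<^sup>+x. w (x + s *\<^sub>R v) * indicator {0..1::real} s \<partial>lborel) \<partial>lborel)"
    by (rule lborel_pair.Fubini') measurable
  also have "(\<lambda>s. \<integral>\<^sup>+x. w (x + s *\<^sub>R v) * indicator {0..1::real} s \<partial>lborel)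
      = (\<lambda>s. (\<integral>\<^sup>+x. w x \<partial>lborel) * indicator {0..1::real} s)"
    using nn_integral_lborel_affine[of w 1] by (simp add: nn_integral_multc)
  also have "(\<integral>\<^sup>+s. (\<integral>\<^sup>+x. w x \<partial>lborel) * indicator {0..1::real} s \<partial>lborel) = (\<integral>\<^sup>+x. w x \<partial>lborel)"
    by (simp add: nn_integral_cmult_indicator)
  also have "\<dots> = ennreal (norm v powr p) * dirichlet_energy p E \<phi>"
    by (simp add: dirichlet_energy_test_function[OF \<phi>] w_def powr_mult ennreal_mult nn_integral_cmult)
  finally show ?thesis .
qed

lemma le_cmult_InfI_ennreal:
  fixes a :: ennreal
  assumes c: "0 < c" and le: "\<And>e. e \<in> A \<Longrightarrow> a \<le> ennreal c * e"
  shows "a \<le> ennreal c * Inf A"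
proof -
  have "a / ennreal c \<le> Inf A"
    using c le by (intro Inf_greatest divide_le_posI_ennreal) (auto simp: mult.commute)
  then have "ennreal c * (a / ennreal c) \<le> ennreal c * Inf A"
    by (rule mult_left_mono) simp
  then show ?thesis
    using c by (simp add: ennreal_times_divide mult.commute[of _ a] ennreal_mult_divide_eq)
qed

text \<open>From a point at distance at most \<open>r\<close> from the centre, a displacement of length \<open>3r\<close> in any
  direction leads out of the ball of radius \<open>2r\<close>.\<close>

lemma emeasure_le_rel_capacity:
  fixes x0 :: "'a::euclidean_space"
  assumes r: "0 < r" and p: "1 \<le> p" and S: "S \<in> sets borel" "S \<subseteq> cball x0 r"
  shows "emeasure lborel S \<le> ennreal ((3 * r) powr p) * rel_capacity p S (ball x0 (2 * r))"
proof -
  obtain b :: 'a where b: "b \<in> Basis" using nonempty_Basis by blast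
  \<comment> \<open>The direction is arbitrary; a basis vector is a convenient unit vector.\<close>
  define v where "v = (3 * r) *\<^sub>R b"
  have v: "norm v = 3 * r" using b r by (simp add: v_def)
  have exit: "x + v \<notin> ball x0 (2 * r)" if "x \<in> S" for x
  proof -
    have "norm v \<le> norm ((x + v) - x0) + norm (x0 - x)"
      using norm_triangle_ineq[of "x + v - x0" "x0 - x"] by simp
    moreover have "norm (x0 - x) \<le> r" using that S by (auto simp: dist_norm)
    ultimately show ?thesis using v by (simp add: dist_norm norm_minus_commute)
  qed
  show ?thesis
    unfolding rel_capacity_def
    using emeasure_le_dirichlet_energy[OF _ p S(1) _ exit] r
    by (intro le_cmult_InfI_ennreal) (auto simp: v)
qed

section \<open>Scaling of the capacity of balls\<close>

lemma frechet_derivative_affine: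
  fixes f :: "'a::euclidean_space \<Rightarrow> real"
  assumes f: "\<And>y. f differentiable (at y)"
  shows "(\<lambda>x. c * f (m *\<^sub>R x + a)) differentiable (at x)"
    and "frechet_derivative (\<lambda>x. c * f (m *\<^sub>R x + a)) (at x) v
           = c * m * frechet_derivative f (at (m *\<^sub>R x + a)) v"
proof -
  let ?D = "frechet_derivative f (at (m *\<^sub>R x + a))"
  have D: "(f has_derivative ?D) (at (m *\<^sub>R x + a))"
    using f frechet_derivative_works by blast
  have "((\<lambda>x. c * f (m *\<^sub>R x + a)) has_derivative (\<lambda>v. c * ?D (m *\<^sub>R v))) (at x)"
    by (rule has_derivative_mult_right, rule has_derivative_compose[where f = "\<lambda>x. m *\<^sub>R x + a" and g = f and g' = ?D])
      (auto intro!: derivative_eq_intros D)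
  also have "(\<lambda>v. c * ?D (m *\<^sub>R v)) = (\<lambda>v. c * m * ?D v)"
    using linear_scale[OF has_derivative_linear[OF D]] by auto
  finally have *: "((\<lambda>x. c * f (m *\<^sub>R x + a)) has_derivative (\<lambda>v. c * m * ?D v)) (at x)" .
  then show "(\<lambda>x. c * f (m *\<^sub>R x + a)) differentiable (at x)"
    unfolding differentiable_def by blast
  show "frechet_derivative (\<lambda>x. c * f (m *\<^sub>R x + a)) (at x) v = c * m * ?D v"
    using frechet_derivative_at[OF *] by metis
qed

text \<open>The factor \<open>c\<close> is carried along because each differentiation multiplies it by \<open>m\<close>.\<close>

lemma C_k_affine: "C_k k f \<Longrightarrow> C_k k (\<lambda>x. c * f (m *\<^sub>R x + a))"
proof (induction k arbitrary: f c)
  case 0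
  then show ?case
    by (auto intro!: continuous_intros intro: continuous_on_compose2[of UNIV f])
next
  case (Suc k)
  then have f: "f differentiable (at x)" for x by simp
  have "C_k k (\<lambda>x. c * m * frechet_derivative f (at (m *\<^sub>R x + a)) b)" if "b \<in> Basis" for b
    using Suc.IH[of "\<lambda>x. frechet_derivative f (at x) b" "c * m"] Suc.prems that by simp
  then show ?case
    using frechet_derivative_affine[OF f] by simp
qed

lemma smooth_affine: "smooth f \<Longrightarrow> smooth (\<lambda>x. f (m *\<^sub>R x + a))"
  using C_k_affine[of _ f 1 m a] by (simp add: smooth_def)

lemma gradient_affine:
  assumes "smooth f"
  shows "gradient (\<lambda>x. f (m *\<^sub>R x + a)) x = m *\<^sub>R gradient f (m *\<^sub>R x + a)"
  using frechet_derivative_affine(2)[OF smooth_differentiable[OF assms], of 1]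
  by (simp add: gradient_def scaleR_sum_right)

text \<open>The map \<open>x \<mapsto> (x - x\<^sub>0) / r\<close> is written as a dilation followed by a translation, the form in
  which its derivatives were computed.\<close>

lemma test_function_rescale:
  fixes \<phi> :: "'a::euclidean_space \<Rightarrow> real"
  assumes \<phi>: "\<phi> \<in> test_functions (ball 0 2)" and r: "0 < r"
  shows "(\<lambda>x. \<phi> ((1 / r) *\<^sub>R x + - (1 / r) *\<^sub>R x0)) \<in> test_functions (ball x0 (2 * r))"
    (is "?\<psi> \<in> _")
proof -
  let ?K = "closure {x. \<phi> x \<noteq> 0}"
  let ?T = "(\<lambda>y. r *\<^sub>R y + x0) ` ?K"
  have K: "compact ?K" "?K \<subseteq> ball 0 2" using \<phi> by (auto simp: test_functions_def)
  have T: "compact ?T"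
    by (intro compact_continuous_image continuous_intros K)
  have "{x. ?\<psi> x \<noteq> 0} \<subseteq> ?T"
  proof
    fix x assume "x \<in> {x. ?\<psi> x \<noteq> 0}"
    then have "(1 / r) *\<^sub>R x + - (1 / r) *\<^sub>R x0 \<in> ?K"
      using closure_subset[of "{x. \<phi> x \<noteq> 0}"] by auto
    moreover have "x = r *\<^sub>R ((1 / r) *\<^sub>R x + - (1 / r) *\<^sub>R x0) + x0"
      using r by (simp add: algebra_simps)
    ultimately show "x \<in> ?T" by (rule rev_image_eqI)
  qed
  then have sub: "closure {x. ?\<psi> x \<noteq> 0} \<subseteq> ?T"
    by (intro closure_minimal compact_imp_closed T)
  moreover have "?T \<subseteq> ball x0 (2 * r)"
    using K(2) r by (auto simp: dist_norm subset_iff)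
  moreover have "compact (closure {x. ?\<psi> x \<noteq> 0})"
    using compact_Int_closed[OF T closed_closure[of "{x. ?\<psi> x \<noteq> 0}"]] sub
    by (simp add: Int_absorb1)
  moreover have "smooth ?\<psi>" using \<phi> by (intro smooth_affine) (simp add: test_functions_def)
  ultimately show ?thesis by (auto simp: test_functions_def)
qed

text \<open>Each gradient gains a factor \<open>1 / r\<close> and the volume element a factor \<open>r\<^sup>N\<close>.\<close>

lemma dirichlet_energy_rescale:
  fixes \<phi> :: "'a::euclidean_space \<Rightarrow> real"
  assumes \<phi>: "\<phi> \<in> test_functions (ball 0 2)" and r: "0 < r"
  shows "dirichlet_energy p (ball x0 (2 * r)) (\<lambda>x. \<phi> ((1 / r) *\<^sub>R x + - (1 / r) *\<^sub>R x0))
    = ennreal (r ^ DIM('a) / r powr p) * dirichlet_energy p (ball 0 2) \<phi>"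
proof -
  define m where "m = 1 / r"
  define a where "a = - m *\<^sub>R x0"
  have m: "0 < m" using r by (simp add: m_def)
  have smooth: "smooth \<phi>" using \<phi> by (simp add: test_functions_def)
  note [measurable] = borel_measurable_gradient[OF smooth]
  let ?J = "\<integral>\<^sup>+x. ennreal (norm (gradient \<phi> (m *\<^sub>R x + a)) powr p) \<partial>lborel"
  have "dirichlet_energy p (ball x0 (2 * r)) (\<lambda>x. \<phi> (m *\<^sub>R x + a)) = ennreal (m powr p) * ?J"
    using test_function_rescale[OF \<phi> r, of x0, folded m_def, folded a_def] m
    by (simp add: dirichlet_energy_test_function gradient_affine[OF smooth] powr_mult
        ennreal_mult nn_integral_cmult)
  moreover have "dirichlet_energy p (ball 0 2) \<phi> = ennreal (m ^ DIM('a)) * ?J"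
    unfolding dirichlet_energy_test_function[OF \<phi>]
    by (rule nn_integral_lborel_affine) (use m in auto)
  moreover have "r ^ DIM('a) / r powr p * m ^ DIM('a) = m powr p"
    using r by (simp add: m_def powr_divide power_one_over)
  ultimately show ?thesis
    using r m by (simp add: m_def a_def mult.assoc[symmetric] flip: ennreal_mult)
qed

lemma rel_capacity_cball_le:
  fixes x0 :: "'a::euclidean_space"
  assumes r: "0 < r"
  shows "rel_capacity p (cball x0 r) (ball x0 (2 * r))
    \<le> ennreal (r ^ DIM('a) / r powr p) * rel_capacity p (cball (0::'a) 1) (ball 0 2)"
proof (subst (2) rel_capacity_def, rule le_cmult_InfI_ennreal)
  fix e assume "e \<in> {dirichlet_energy p (ball (0::'a) 2) \<phi> |\<phi>. \<phi> \<in> test_functions (ball 0 2) \<and> (\<forall>x\<in>cball 0 1. 1 \<le> \<phi> x)}"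
  then obtain \<phi> where \<phi>: "\<phi> \<in> test_functions (ball (0::'a) 2)" "\<And>x. norm x \<le> 1 \<Longrightarrow> 1 \<le> \<phi> x"
    and e: "e = dirichlet_energy p (ball 0 2) \<phi>" by auto
  have "1 \<le> \<phi> ((1 / r) *\<^sub>R x + - (1 / r) *\<^sub>R x0)" if "x \<in> cball x0 r" for x
  proof (rule \<phi>(2))
    have "(1 / r) *\<^sub>R x + - (1 / r) *\<^sub>R x0 = (1 / r) *\<^sub>R (x - x0)" by (simp add: algebra_simps)
    then show "norm ((1 / r) *\<^sub>R x + - (1 / r) *\<^sub>R x0) \<le> 1"
      using that r by (simp add: dist_norm norm_minus_commute)
  qed
  then show "rel_capacity p (cball x0 r) (ball x0 (2 * r)) \<le> ennreal (r ^ DIM('a) / r powr p) * e"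
    unfolding rel_capacity_def e dirichlet_energy_rescale[OF \<phi>(1) r, of p x0, symmetric]
    using test_function_rescale[OF \<phi>(1) r, of x0]
    by (intro Inf_lower) blast
qed (use r in simp)

text \<open>The powers \<open>r\<^sup>p\<close> in the volume bound and \<open>r\<^sup>N\<^sup>-\<^sup>p\<close> in the capacity of the ball multiply to
  \<open>r\<^sup>N\<close>, so an admissible ball in the definition of the capacitary inradius has a complement of
  \<open>\<Omega>\<close> whose relative volume is at most a multiple of \<open>\<gamma>\<close>, uniformly in \<open>r\<close>.\<close>

lemma emeasure_le_of_small_capacity:
  fixes x0 :: "'a::euclidean_space"
  assumes r: "0 < r" and p: "1 \<le> p" and \<Omega>: "open \<Omega>"
    and cap: "rel_capacity p (closure (ball x0 r) - \<Omega>) (ball x0 (2 * r))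
              \<le> ennreal \<gamma> * rel_capacity p (closure (ball x0 r)) (ball x0 (2 * r))"
    and \<gamma>: "0 < \<gamma>"
  shows "emeasure lborel (ball x0 r - \<Omega>)
    \<le> ennreal (3 powr p * \<gamma> * r ^ DIM('a)) * rel_capacity p (cball (0::'a) 1) (ball 0 2)"
proof -
  have cl: "closure (ball x0 r) = cball x0 r" using r by simp
  have "emeasure lborel (ball x0 r - \<Omega>) \<le> emeasure lborel (cball x0 r - \<Omega>)"
    using \<Omega> by (intro emeasure_mono) auto
  also have "\<dots> \<le> ennreal ((3 * r) powr p) * rel_capacity p (cball x0 r - \<Omega>) (ball x0 (2 * r))"
    using \<Omega> by (intro emeasure_le_rel_capacity r p) auto
  also have "\<dots> \<le> ennreal ((3 * r) powr p) * (ennreal \<gamma> *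
      (ennreal (r ^ DIM('a) / r powr p) * rel_capacity p (cball (0::'a) 1) (ball 0 2)))"
    using order_trans[OF cap[unfolded cl] mult_left_mono[OF rel_capacity_cball_le[OF r, of p x0]]]
    by (intro mult_left_mono) auto
  also have "\<dots> = ennreal (3 powr p * \<gamma> * r ^ DIM('a)) * rel_capacity p (cball (0::'a) 1) (ball 0 2)"
    using r \<gamma> by (simp add: mult.assoc[symmetric] powr_mult flip: ennreal_mult)
  finally show ?thesis .
qed

section \<open>Volume of the complement in large balls\<close>

text \<open>The volume of the pairs \<open>(y, z)\<close> with \<open>z \<in> A\<close> in \<open>ball x0 r\<close> and \<open>|y - z| < \<rho>\<close> is computed in two
  ways: each \<open>y\<close> in the smaller ball is near a set of such \<open>z\<close> of volume at least \<open>c\<close>, and each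
  \<open>z\<close> is near a set of \<open>y\<close> of volume \<open>|B\<^sub>\<rho>|\<close>. This plays the part of a packing of the large ball
  by small ones.\<close>

lemma emeasure_averaging:
  fixes x0 :: "'a::euclidean_space"
  assumes A[measurable]: "A \<in> sets borel" and \<rho>: "0 \<le> \<rho>"
    and c: "\<And>y. y \<in> ball x0 (r - \<rho>) \<Longrightarrow> c \<le> emeasure lborel (ball y \<rho> \<inter> A)"
  shows "c * emeasure lborel (ball x0 (r - \<rho>))
    \<le> emeasure lborel (ball x0 r \<inter> A) * emeasure lborel (ball (0::'a) \<rho>)"
proof -
  let ?near = "\<lambda>y z. indicator {..<\<rho>} (dist y z) :: ennreal"
  define g :: "'a \<Rightarrow> ennreal" where "g = indicator (ball x0 r \<inter> A)"
  have [measurable]: "g \<in> borel_measurable borel" 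
    unfolding g_def using A by (intro borel_measurable_indicator sets.Int) auto
  have "c * emeasure lborel (ball x0 (r - \<rho>)) = (\<integral>\<^sup>+y. c * indicator (ball x0 (r - \<rho>)) y \<partial>lborel)"
    by (simp add: nn_integral_cmult_indicator)
  also have "\<dots> \<le> (\<integral>\<^sup>+y. (\<integral>\<^sup>+z. ?near y z * g z \<partial>lborel) \<partial>lborel)"
  proof (rule nn_integral_mono)
    fix y :: 'a
    show "c * indicator (ball x0 (r - \<rho>)) y
      \<le> (\<integral>\<^sup>+z. ?near y z * g z \<partial>lborel)"
    proof (cases "y \<in> ball x0 (r - \<rho>)")
      case True
      have sub: "ball y \<rho> \<subseteq> ball x0 r"
      proof
        fix z assume "z \<in> ball y \<rho>"
        then show "z \<in> ball x0 r" using True dist_triangle[of x0 z y] by simp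
      qed
      have "c * indicator (ball x0 (r - \<rho>)) y \<le> emeasure lborel (ball y \<rho> \<inter> A)"
        using c[OF True] True by simp
      also have "\<dots> = (\<integral>\<^sup>+z. indicator (ball y \<rho> \<inter> A) z \<partial>lborel)" by simp
      also have "\<dots> = (\<integral>\<^sup>+z. ?near y z * g z \<partial>lborel)"
        using sub by (intro nn_integral_cong) (auto simp: indicator_def g_def)
      finally show ?thesis .
    qed simp
  qed
  also have "\<dots> = (\<integral>\<^sup>+z. (\<integral>\<^sup>+y. ?near y z * g z \<partial>lborel) \<partial>lborel)"
    by (rule lborel_pair.Fubini') measurable
  also have "\<dots> = (\<integral>\<^sup>+z. emeasure lborel (ball (0::'a) \<rho>) * g z \<partial>lborel)"
  proof (rule nn_integral_cong)
    fix z :: 'a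
    have "(\<integral>\<^sup>+y. ?near y z \<partial>lborel) = (\<integral>\<^sup>+y. indicator (ball z \<rho>) y \<partial>lborel)"
      by (intro nn_integral_cong) (auto simp: indicator_def dist_commute)
    also have "\<dots> = emeasure lborel (ball (0::'a) \<rho>)"
      using \<rho> by (simp add: emeasure_ball)
    finally show "(\<integral>\<^sup>+y. ?near y z * g z \<partial>lborel)
        = emeasure lborel (ball (0::'a) \<rho>) * g z"
      by (simp add: nn_integral_multc)
  qed
  also have "\<dots> = emeasure lborel (ball x0 r \<inter> A) * emeasure lborel (ball (0::'a) \<rho>)"
    by (simp add: g_def nn_integral_cmult_indicator mult.commute)
  finally show ?thesis .
qed

lemma emeasure_ball_diff_eq:
  "emeasure lborel (ball x r - A) = ennreal (measure lborel (ball x r - A))"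
proof (rule emeasure_eq_ennreal_measure)
  have "emeasure lborel (ball x r - A) \<le> emeasure lborel (ball x r)" by (rule emeasure_mono) auto
  then show "emeasure lborel (ball x r - A) \<noteq> top"
    using emeasure_lborel_ball_finite[of x r] by (auto simp: top_unique)
qed

text \<open>If the ball \<open>B\<^sub>\<rho>(y)\<close> misses \<open>\<Omega>\<close>, all of it counts. Otherwise, being connected, it contains a
  boundary point \<open>x\<close>, and the density index applies to \<open>B\<^sub>s(x)\<close> with \<open>s = min \<rho> r\<^sub>0\<close>, which is
  contained in \<open>B\<^sub>2\<^sub>\<rho>(y)\<close>; the two minima in the statement are \<open>s / r\<^sub>0\<close> and \<open>s / \<rho>\<close>.\<close>

lemma measure_ge_if_not_subset:
  fixes \<Omega> :: "'a::euclidean_space set"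
  assumes \<Omega>: "open \<Omega>" and \<theta>: "0 \<le> \<theta>" "\<theta> \<le> 1" "ennreal \<theta> \<le> measure_density_index \<Omega> r0 t"
    and r0: "0 < r0" and t: "0 \<le> t" and \<rho>: "0 < \<rho>" and y: "\<not> ball y \<rho> \<subseteq> \<Omega>"
  shows "\<theta> * min 1 (\<rho> / r0) powr t * min 1 (r0 / \<rho>) ^ DIM('a) * (unit_ball_vol DIM('a) * \<rho> ^ DIM('a))
    \<le> measure lborel (ball y (2 * \<rho>) - \<Omega>)"
proof -
  define s where "s = min \<rho> r0"
  have s: "0 < s" "s \<le> r0" "s \<le> \<rho>" using \<rho> r0 by (auto simp: s_def)
  have s1: "min 1 (\<rho> / r0) = s / r0" "min 1 (r0 / \<rho>) = s / \<rho>"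
    using \<rho> r0 by (auto simp: s_def min_def field_simps)
  have fin: "emeasure lborel (ball y (2 * \<rho>) - \<Omega>) \<noteq> \<infinity>"
    by (simp add: emeasure_ball_diff_eq)
  have mono: "measure lborel B \<le> measure lborel (ball y (2 * \<rho>) - \<Omega>)"
    if "B \<subseteq> ball y (2 * \<rho>) - \<Omega>" "B \<in> sets borel" for B
    using that \<Omega> fin by (intro measure_mono_fmeasurable) (auto simp: fmeasurable_def less_top)
  show ?thesis
  proof (cases "ball y \<rho> \<inter> \<Omega> = {}")
    case True
    have "\<theta> * (s / r0) powr t * (s / \<rho>) ^ DIM('a) \<le> 1"
      using \<theta> s \<rho> r0 t by (intro mult_le_one powr_le1 power_le_one) auto
    then have "\<theta> * (s / r0) powr t * (s / \<rho>) ^ DIM('a) * (unit_ball_vol DIM('a) * \<rho> ^ DIM('a))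
        \<le> measure lborel (ball y \<rho>)"
      using \<rho> by (subst content_ball) (auto intro!: mult_left_le_one_le simp: \<theta>)
    also have "\<dots> \<le> measure lborel (ball y (2 * \<rho>) - \<Omega>)"
      using True \<rho> by (intro mono) auto
    finally show ?thesis by (simp add: s1)
  next
    case False
    then obtain x where x: "x \<in> ball y \<rho>" "x \<in> frontier \<Omega>"
      using connected_Int_frontier[of "ball y \<rho>" \<Omega>] y by auto
    let ?V = "unit_ball_vol DIM('a) * s ^ DIM('a)"
    have V: "0 < ?V" using s by simp
    have "ennreal \<theta> \<le> ennreal ((r0 / s) powr t) *
        (emeasure lborel (ball x s - \<Omega>) / emeasure lborel (ball x s))"
      using \<theta>(3) unfolding measure_density_index_def
      by (rule order_trans) (rule Inf_lower, use x s in blast)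
    also have "emeasure lborel (ball x s - \<Omega>) / emeasure lborel (ball x s)
        = ennreal (measure lborel (ball x s - \<Omega>) / ?V)"
      unfolding emeasure_ball_diff_eq emeasure_ball[OF less_imp_le[OF s(1)]]
      by (rule divide_ennreal) (use V in auto)
    also have "ennreal ((r0 / s) powr t) * \<dots> = ennreal ((r0 / s) powr t * (measure lborel (ball x s - \<Omega>) / ?V))"
      using V by (intro ennreal_mult[symmetric]) auto
    finally have "\<theta> \<le> (r0 / s) powr t * (measure lborel (ball x s - \<Omega>) / ?V)"
      using V by (subst (asm) ennreal_le_iff) auto
    then have "\<theta> * ((s / r0) powr t * ?V)
        \<le> (r0 / s) powr t * (measure lborel (ball x s - \<Omega>) / ?V) * ((s / r0) powr t * ?V)"
      using V by (intro mult_right_mono) auto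
    also have "\<dots> = ((r0 / s) powr t * (s / r0) powr t) * measure lborel (ball x s - \<Omega>)"
      using less_imp_neq[OF V] by simp
    also have "(r0 / s) powr t * (s / r0) powr t = 1"
      using s r0 by (simp add: powr_divide)
    also have "1 * measure lborel (ball x s - \<Omega>) \<le> measure lborel (ball y (2 * \<rho>) - \<Omega>)"
    proof (subst mult_1, rule mono)
      show "ball x s - \<Omega> \<subseteq> ball y (2 * \<rho>) - \<Omega>"
      proof
        fix z assume "z \<in> ball x s - \<Omega>"
        then show "z \<in> ball y (2 * \<rho>) - \<Omega>"
          using x(1) s dist_triangle[of y z x] by auto
      qed
    qed (use \<Omega> in auto)
    also have "\<theta> * ((s / r0) powr t * ?V)
      = \<theta> * (s / r0) powr t * (s / \<rho>) ^ DIM('a) * (unit_ball_vol DIM('a) * \<rho> ^ DIM('a))"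
      using \<rho> by (simp add: power_divide)
    finally show ?thesis by (simp add: s1)
  qed
qed

lemma not_ball_subset_if_inradius_less:
  assumes "inradius \<Omega> < ennreal \<rho>" "0 < \<rho>"
  shows "\<not> ball y \<rho> \<subseteq> \<Omega>"
proof
  assume "ball y \<rho> \<subseteq> \<Omega>"
  then have "ennreal \<rho> \<le> inradius \<Omega>"
    unfolding inradius_def using assms(2) by (intro Sup_upper) blast
  then show False using assms(1) by simp
qed

text \<open>The local bound in balls of radius \<open>2\<rho>\<close> is averaged over centres in the ball of radius
  \<open>r - 2\<rho> \<ge> 2r / 3\<close>. The ratio \<open>(r - 2\<rho>) / 2 \<ge> r / 3\<close> is where the constant \<open>1 / 3\<close> comes from.\<close>

lemma measure_ball_diff_ge:
  fixes \<Omega> :: "'a::euclidean_space set"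
  assumes \<Omega>: "open \<Omega>" and \<theta>: "0 \<le> \<theta>" "\<theta> \<le> 1" "ennreal \<theta> \<le> measure_density_index \<Omega> r0 t"
    and r0: "0 < r0" and t: "0 \<le> t" and \<rho>: "0 < \<rho>" "inradius \<Omega> < ennreal \<rho>" and r: "6 * \<rho> \<le> r"
  shows "\<theta> * min 1 (\<rho> / r0) powr t * min 1 (r0 / \<rho>) ^ DIM('a) * (unit_ball_vol DIM('a) * (r / 3) ^ DIM('a))
    \<le> measure lborel (ball x0 r - \<Omega>)"
proof -
  let ?N = "DIM('a)"
  define V where "V = unit_ball_vol (real ?N)"
  define \<delta> where "\<delta> = \<theta> * min 1 (\<rho> / r0) powr t * min 1 (r0 / \<rho>) ^ ?N"
  have V: "0 < V" by (simp add: V_def)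
  have \<delta>: "0 \<le> \<delta>" using \<theta> r0 \<rho> by (simp add: \<delta>_def)
  have "ennreal (\<delta> * (V * \<rho> ^ ?N)) * emeasure lborel (ball x0 (r - 2 * \<rho>))
      \<le> emeasure lborel (ball x0 r \<inter> - \<Omega>) * emeasure lborel (ball (0::'a) (2 * \<rho>))"
  proof (rule emeasure_averaging)
    fix y
    have "ennreal (\<delta> * (V * \<rho> ^ ?N)) \<le> ennreal (measure lborel (ball y (2 * \<rho>) - \<Omega>))"
      unfolding \<delta>_def V_def
      by (intro ennreal_leI measure_ge_if_not_subset not_ball_subset_if_inradius_less assms)
    then show "ennreal (\<delta> * (V * \<rho> ^ ?N)) \<le> emeasure lborel (ball y (2 * \<rho>) \<inter> - \<Omega>)"
      by (simp add: Diff_eq[symmetric] emeasure_ball_diff_eq)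
  qed (use \<Omega> \<rho> in auto)
  then have "\<delta> * (V * \<rho> ^ ?N) * (V * (r - 2 * \<rho>) ^ ?N)
      \<le> measure lborel (ball x0 r - \<Omega>) * (V * (2 * \<rho>) ^ ?N)"
    using V \<delta> \<rho> r
    by (simp add: Diff_eq[symmetric] emeasure_ball_diff_eq emeasure_ball V_def[symmetric] flip: ennreal_mult)
  also have "\<dots> = (V * \<rho> ^ ?N) * (measure lborel (ball x0 r - \<Omega>) * 2 ^ ?N)"
    by (simp add: power_mult_distrib)
  finally have "(V * \<rho> ^ ?N) * (\<delta> * V * (r - 2 * \<rho>) ^ ?N)
      \<le> (V * \<rho> ^ ?N) * (measure lborel (ball x0 r - \<Omega>) * 2 ^ ?N)"
    by (simp add: mult_ac)
  then have "\<delta> * V * (r - 2 * \<rho>) ^ ?N \<le> measure lborel (ball x0 r - \<Omega>) * 2 ^ ?N"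
    using V \<rho> by (simp add: mult_le_cancel_left_pos)
  moreover have "\<delta> * V * (2 * (r / 3)) ^ ?N \<le> \<delta> * V * (r - 2 * \<rho>) ^ ?N"
    using \<delta> V r \<rho> by (intro mult_left_mono power_mono) auto
  moreover have "\<delta> * V * (2 * (r / 3)) ^ ?N = \<delta> * V * (r / 3) ^ ?N * 2 ^ ?N"
    by (simp only: power_mult_distrib mult_ac)
  ultimately have "\<delta> * V * (r / 3) ^ ?N * 2 ^ ?N \<le> measure lborel (ball x0 r - \<Omega>) * 2 ^ ?N"
    by linarith
  then have "\<delta> * V * (r / 3) ^ ?N \<le> measure lborel (ball x0 r - \<Omega>)" by simp
  then show ?thesis by (simp add: \<delta>_def V_def mult.assoc)
qed

lemma measure_density_index_le_1:
  fixes \<Omega> :: "'a::euclidean_space set"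
  assumes "open \<Omega>" "\<Omega> \<noteq> {}" "\<Omega> \<noteq> UNIV" "0 < r0"
  shows "measure_density_index \<Omega> r0 t \<le> 1"
proof -
  obtain x where x: "x \<in> frontier \<Omega>"
    using assms frontier_eq_empty[of \<Omega>] by auto
  have "measure_density_index \<Omega> r0 t \<le> ennreal ((r0 / r0) powr t) *
      (emeasure lborel (ball x r0 - \<Omega>) / emeasure lborel (ball x r0))"
    unfolding measure_density_index_def using x assms(4) by (intro Inf_lower) blast
  also have "\<dots> \<le> 1 * (emeasure lborel (ball x r0) / emeasure lborel (ball x r0))"
    using assms(4) by (intro mult_mono divide_right_mono_ennreal emeasure_mono) auto
  also have "\<dots> \<le> 1"
    by (simp add: divide_le_posI_ennreal) (use ennreal_divide_self[of "emeasure lborel (ball x r0)"] emeasure_lborel_ball_finite[of x r0] in \<open>cases "emeasure lborel (ball x r0) = 0"; simp\<close>)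
  finally show ?thesis .
qed

section \<open>The inradius is at most the capacitary inradius\<close>

lemma inradius_pos:
  assumes "open \<Omega>" "\<Omega> \<noteq> {}"
  shows "0 < inradius \<Omega>"
proof -
  obtain x e where "0 < e" "ball x e \<subseteq> \<Omega>" using assms by (metis openE ex_in_conv)
  then have "ennreal e \<le> inradius \<Omega>"
    unfolding inradius_def by (intro Sup_upper) blast
  then show ?thesis using \<open>0 < e\<close> by (metis ennreal_less_zero_iff order_less_le_trans)
qed

lemma C_k_const: "C_k k (\<lambda>x. c)"
  by (induction k arbitrary: c) simp_all

lemma rel_capacity_empty: "rel_capacity p {} E = 0"
proof -
  have "dirichlet_energy p E (\<lambda>x. 0) = 0"
    by (simp add: dirichlet_energy_def gradient_def)
  moreover have "(\<lambda>x. 0) \<in> test_functions E"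
    by (simp add: test_functions_def smooth_def C_k_const)
  ultimately have "rel_capacity p {} E \<le> 0"
    unfolding rel_capacity_def by (intro Inf_lower) force
  then show ?thesis by simp
qed

text \<open>Balls slightly smaller than one contained in \<open>\<Omega>\<close> are used, since the definition of the
  capacitary inradius involves closed balls.\<close>

lemma inradius_le_capacitary_inradius:
  fixes \<Omega> :: "'a::euclidean_space set"
  shows "inradius \<Omega> \<le> capacitary_inradius p \<gamma> \<Omega>"
  unfolding inradius_def
proof (rule Sup_least, clarify)
  fix r :: real and x0 :: 'a
  assume r: "0 < r" and sub: "ball x0 r \<subseteq> \<Omega>"
  show "ennreal r \<le> capacitary_inradius p \<gamma> \<Omega>"
  proof (rule dense_le)
    fix y assume y: "y < ennreal r"
    then obtain s where s: "y = ennreal s" "0 \<le> s" "s < r"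
      by (cases y) (auto simp: ennreal_less_iff)
    show "y \<le> capacitary_inradius p \<gamma> \<Omega>"
    proof (cases "s = 0")
      case False
      have empty: "closure (ball x0 s) - \<Omega> = {}"
        using s sub False by (auto simp: subset_iff)
      have "rel_capacity p (closure (ball x0 s) - \<Omega>) (ball x0 (2 * s))
          \<le> ennreal \<gamma> * rel_capacity p (closure (ball x0 s)) (ball x0 (2 * s))"
        unfolding empty rel_capacity_empty by (simp only: zero_le)
      then show ?thesis
        unfolding capacitary_inradius_def s(1) using False s(2)
        by (intro Sup_upper) (auto intro!: exI[of _ s] exI[of _ x0])
    qed (use s in simp)
  qed
qed

section \<open>Consequences of the two-sided estimate\<close>

text \<open>Solving \<open>a / y\<^sup>p \<le> b / x\<^sup>p\<close> for \<open>x\<close> in \<open>[0, \<infinity>]\<close>.\<close>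

lemma le_if_enn_powr_inverse_le:
  fixes x y :: ennreal
  assumes le: "ennreal a * enn_powr (1 / y) p \<le> ennreal b * enn_powr (1 / x) p"
    and a: "0 < a" and b: "0 < b" and p: "1 \<le> p"
  shows "x \<le> ennreal ((b / a) powr (1 / p)) * y"
proof -
  consider "y = \<infinity>" | "x = 0" | "y = 0" "x \<noteq> 0" | "x = \<infinity>" "y \<noteq> \<infinity>" "y \<noteq> 0" 
    | u v where "x = ennreal u" "y = ennreal v" "0 < u" "0 < v"
    by (cases x; cases y) (auto simp: less_le)
  then show ?thesis
  proof cases
    case 1
    then show ?thesis using a b by (simp add: ennreal_mult_top)
  next
    case 3
    then have "enn_powr (1 / y) p = \<infinity>" by (simp add: enn_powr_def ennreal_divide_zero)
    moreover have "1 / x \<noteq> \<infinity>" using 3 by (simp add: ennreal_divide_eq_top_iff)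
    ultimately show ?thesis using le a b by (simp add: enn_powr_def ennreal_mult_top ennreal_mult_eq_top_iff top_unique)
  next
    case 4
    obtain v where v: "y = ennreal v" "0 < v"
      using 4 by (cases y) (auto simp: less_le)
    have "enn_powr (1 / x) p = 0" using 4 by (simp add: enn_powr_def)
    moreover have "1 / y = ennreal (1 / v)" using v divide_ennreal[of 1 v] by simp
    then have "enn_powr (1 / y) p = ennreal ((1 / v) powr p)"
      using v by (simp add: enn_powr_def)
    ultimately show ?thesis using le a v by (simp flip: ennreal_mult)
  next
    case (5 u v)
    have inv: "1 / ennreal z = ennreal (1 / z)" if "0 < z" for z
      using that divide_ennreal[of 1 z] by simp
    have "ennreal (a * (1 / v) powr p) \<le> ennreal (b * (1 / u) powr p)"
      using le 5 a b by (simp add: inv enn_powr_def ennreal_mult)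
    then have "a * (1 / v) powr p \<le> b * (1 / u) powr p"
      using b by (subst (asm) ennreal_le_iff) auto
    then have "u powr p \<le> (b / a) * v powr p"
      using 5 a b by (simp add: powr_divide field_simps)
    then have "(u powr p) powr (1 / p) \<le> ((b / a) * v powr p) powr (1 / p)"
      using p by (intro powr_mono2) auto
    also have "(u powr p) powr (1 / p) = u"
      using 5 p by (simp add: powr_powr)
    also have "((b / a) * v powr p) powr (1 / p) = (b / a) powr (1 / p) * v"
      using 5 a b p by (subst powr_mult) (simp_all add: powr_powr)
    finally have "u \<le> (b / a) powr (1 / p) * v" .
    then show ?thesis using 5 by (simp flip: ennreal_mult)
  qed simp
qed

lemma capacitary_inradius_comparison:
  fixes \<Omega> :: "'a::euclidean_space set"
  assumes est: "two_sided_estimate_constants TYPE('a) \<sigma> C"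
    and p: "1 \<le> p" "p \<le> real DIM('a)" and \<Omega>: "open \<Omega>"
    and \<gamma>: "0 < \<gamma>" "\<gamma> < 1" and \<gamma>': "0 < \<gamma>'" "\<gamma>' < 1"
  shows "capacitary_inradius p \<gamma> \<Omega>
    \<le> ennreal ((C p \<gamma> / (\<sigma> p * \<gamma>')) powr (1 / p)) * capacitary_inradius p \<gamma>' \<Omega>"
proof (rule le_if_enn_powr_inverse_le)
  show "ennreal (\<sigma> p * \<gamma>') * enn_powr (1 / capacitary_inradius p \<gamma>' \<Omega>) p
      \<le> ennreal (C p \<gamma>) * enn_powr (1 / capacitary_inradius p \<gamma> \<Omega>) p"
    using est p \<Omega> \<gamma> \<gamma>' unfolding two_sided_estimate_constants_def by (meson order_trans)
qed (use est p \<gamma> \<gamma>' in \<open>auto simp: two_sided_estimate_constants_def\<close>)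

text \<open>No test function on the empty set is normalised, so the Poincare constant is an infimum over
  the empty set, and the upper half of the estimate leaves only \<open>1 / R = \<infinity>\<close>.\<close>

lemma capacitary_inradius_empty:
  assumes est: "two_sided_estimate_constants TYPE('a::euclidean_space) \<sigma> C"
    and p: "1 \<le> p" "p \<le> real DIM('a)" and \<gamma>: "0 < \<gamma>" "\<gamma> < 1"
  shows "capacitary_inradius p \<gamma> ({} :: 'a set) = 0"
proof -
  have "Lp_norm p {} f \<noteq> 1" for f :: "'a \<Rightarrow> real"
    by (simp add: Lp_norm_def enn_powr_def)
  then have "poincare_constant p ({} :: 'a set) = \<infinity>"
    by (simp add: poincare_constant_def)
  then have "ennreal (C p \<gamma>) * enn_powr (1 / capacitary_inradius p \<gamma> ({} :: 'a set)) p = \<infinity>"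
    using est p \<gamma> unfolding two_sided_estimate_constants_def
    by (metis open_empty top_unique infinity_ennreal_def)
  then have "1 / capacitary_inradius p \<gamma> ({} :: 'a set) = \<infinity>"
    by (auto simp: enn_powr_def ennreal_mult_eq_top_iff split: if_splits)
  then show ?thesis by (simp add: ennreal_divide_eq_top_iff)
qed

text \<open>If the capacity of the unit ball were infinite, the unit ball would be admissible in the
  definition of the capacitary inradius of the empty set.\<close>

lemma rel_capacity_unit_ball_finite:
  assumes "two_sided_estimate_constants TYPE('a::euclidean_space) \<sigma> C"
    and "1 \<le> p" "p \<le> real DIM('a)"
  shows "rel_capacity p (cball (0::'a) 1) (ball 0 2) < \<infinity>"
proof (rule ccontr)
  assume "\<not> ?thesis"
  then have "rel_capacity p (closure (ball (0::'a) 1) - {}) (ball 0 (2 * 1))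
      \<le> ennreal (1 / 2) * rel_capacity p (closure (ball (0::'a) 1)) (ball 0 (2 * 1))"
    by (simp add: less_top[symmetric] ennreal_mult_top)
  then have "ennreal 1 \<le> capacitary_inradius p (1 / 2) ({} :: 'a set)"
    unfolding capacitary_inradius_def by (intro Sup_upper) force
  then show False
    using capacitary_inradius_empty[OF assms, of "1 / 2"] by simp
qed

section \<open>The threshold and the upper bound\<close>

text \<open>With \<open>\<kappa> = r\<^sub>0 / r\<^sub>\<Omega>\<close>, this bounds the fraction in \<open>measure_ge_if_not_subset\<close> from below for
  all radii \<open>\<rho>\<close> between \<open>r\<^sub>\<Omega>\<close> and \<open>2 r\<^sub>\<Omega>\<close>.\<close>

definition density_factor :: "nat \<Rightarrow> real \<Rightarrow> real \<Rightarrow> real \<Rightarrow> real" where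
  "density_factor n \<theta> t \<kappa> = \<theta> * min 1 (1 / \<kappa>) powr t * min 1 (\<kappa> / 2) ^ n"

text \<open>The value of \<open>\<gamma>\<close> at which the bounds \<open>measure_ball_diff_ge\<close> and
  \<open>emeasure_le_of_small_capacity\<close> meet. Adding \<open>1\<close> to the capacity makes the denominator positive
  whatever the capacity is.\<close>

definition threshold_ratio ::
    "'a::euclidean_space itself \<Rightarrow> real \<Rightarrow> real \<Rightarrow> real \<Rightarrow> real \<Rightarrow> real" where
  "threshold_ratio (_ :: 'a itself) p \<theta> t \<kappa> =
     density_factor DIM('a) \<theta> t \<kappa> * unit_ball_vol (real DIM('a)) * (1 / 3) ^ DIM('a) /
       (3 powr p * (1 + enn2real (rel_capacity p (cball (0::'a) 1) (ball 0 2))))"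

text \<open>When the density index is infinite, or \<open>\<kappa> = r\<^sub>0 / r\<^sub>\<Omega>\<close> is infinite or zero, the ratio is zero. For a
  proper open subset of positive index this happens only if the set is empty or its inradius is
  infinite; the upper bound then holds for every \<open>\<gamma>\<close>, and any value in \<open>(0, 1)\<close> will do.\<close>

definition capacity_threshold ::
    "'a::euclidean_space itself \<Rightarrow> real \<Rightarrow> ennreal \<Rightarrow> real \<Rightarrow> ennreal \<Rightarrow> real" where
  "capacity_threshold T p \<theta> t \<kappa> =
     (let X = threshold_ratio T p (enn2real \<theta>) t (enn2real \<kappa>)
      in if 0 < X then min (1 / 2) X else 1 / 2)"

lemma capacity_threshold_bounds: "0 < capacity_threshold T p \<theta> t \<kappa>" "capacity_threshold T p \<theta> t \<kappa> < 1"
  by (auto simp: capacity_threshold_def Let_def)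

text \<open>An admissible ball of radius \<open>r > 6 r\<^sub>\<Omega>\<close> leaves room for a radius \<open>\<rho>\<close> with
  \<open>r\<^sub>\<Omega> < \<rho> \<le> 2 r\<^sub>\<Omega>\<close> and \<open>6\<rho> \<le> r\<close>. Comparing the lower and upper bounds for the volume of the
  complement of \<open>\<Omega>\<close> in the ball then bounds \<open>\<gamma>\<close> from below.\<close>

lemma threshold_ratio_le:
  fixes \<Omega> :: "'a::euclidean_space set"
  assumes p: "1 \<le> p" and \<Omega>: "open \<Omega>"
    and \<theta>: "0 \<le> \<theta>" "\<theta> \<le> 1" "ennreal \<theta> \<le> measure_density_index \<Omega> r0 t"
    and r0: "0 < r0" and t: "0 \<le> t"
    and a: "inradius \<Omega> = ennreal a" "0 < a" and r: "6 * a < r" and \<gamma>: "0 < \<gamma>"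
    and fin: "rel_capacity p (cball (0::'a) 1) (ball 0 2) < \<infinity>"
    and cap: "rel_capacity p (closure (ball x0 r) - \<Omega>) (ball x0 (2 * r))
              \<le> ennreal \<gamma> * rel_capacity p (closure (ball x0 r)) (ball x0 (2 * r))"
  shows "threshold_ratio TYPE('a) p \<theta> t (r0 / a) \<le> \<gamma>"
proof -
  let ?N = "DIM('a)"
  define V where "V = unit_ball_vol (real ?N)"
  define \<delta> where "\<delta> = density_factor ?N \<theta> t (r0 / a)"
  define c where "c = enn2real (rel_capacity p (cball (0::'a) 1) (ball 0 2))"
  have c: "rel_capacity p (cball (0::'a) 1) (ball 0 2) = ennreal c" "0 \<le> c"
    using fin by (simp_all add: c_def)
  have r_pos: "0 < r" using a r by simp
  define \<rho> where "\<rho> = min (2 * a) (r / 6)"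
  have \<rho>: "a < \<rho>" "\<rho> \<le> 2 * a" "6 * \<rho> \<le> r" using a r by (auto simp: \<rho>_def)
  have "\<delta> \<le> \<theta> * min 1 (\<rho> / r0) powr t * min 1 (r0 / \<rho>) ^ ?N"
    unfolding \<delta>_def density_factor_def
  proof (intro mult_mono powr_mono2 power_mono)
    show "min 1 (1 / (r0 / a)) \<le> min 1 (\<rho> / r0)"
      using \<rho> r0 by (intro min.mono) (auto intro: divide_right_mono)
    have "r0 / (2 * a) \<le> r0 / \<rho>"
      using a \<rho> r0 by (intro divide_left_mono) auto
    then show "min 1 (r0 / a / 2) \<le> min 1 (r0 / \<rho>)"
      by (intro min.mono) (auto simp: mult.commute)
  qed (use \<theta> t r0 a \<rho> in auto)
  then have "\<delta> * (V * (r / 3) ^ ?N)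
      \<le> \<theta> * min 1 (\<rho> / r0) powr t * min 1 (r0 / \<rho>) ^ ?N * (V * (r / 3) ^ ?N)"
    using r_pos by (intro mult_right_mono) (auto simp: V_def)
  also have "\<dots> \<le> measure lborel (ball x0 r - \<Omega>)"
    unfolding V_def using a \<rho> by (intro measure_ball_diff_ge \<Omega> \<theta> r0 t) (auto simp: ennreal_less_iff)
  also have "\<dots> \<le> 3 powr p * \<gamma> * r ^ ?N * c"
  proof -
    have "ennreal (measure lborel (ball x0 r - \<Omega>)) \<le> ennreal (3 powr p * \<gamma> * r ^ ?N * c)"
      using emeasure_le_of_small_capacity[OF r_pos p \<Omega> cap \<gamma>] c r_pos \<gamma>
      by (simp add: emeasure_ball_diff_eq flip: ennreal_mult)
    then show ?thesis using c r_pos \<gamma> by (subst (asm) ennreal_le_iff) auto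
  qed
  also have "\<dots> \<le> 3 powr p * \<gamma> * r ^ ?N * (1 + c)"
    using r_pos \<gamma> by (intro mult_left_mono) auto
  finally have "r ^ ?N * (\<delta> * V * (1 / 3) ^ ?N) \<le> r ^ ?N * (\<gamma> * (3 powr p * (1 + c)))"
    by (simp add: power_divide mult_ac)
  then have "\<delta> * V * (1 / 3) ^ ?N \<le> \<gamma> * (3 powr p * (1 + c))"
    using r_pos by (subst (asm) mult_le_cancel_left_pos) auto
  then show ?thesis
    using c unfolding threshold_ratio_def \<delta>_def[symmetric] V_def[symmetric] c_def[symmetric]
    by (subst pos_divide_le_eq) auto
qed

lemma capacitary_inradius_le_6_inradius:
  fixes \<Omega> :: "'a::euclidean_space set"
  assumes p: "1 \<le> p" and \<Omega>: "open \<Omega>" "\<Omega> \<noteq> UNIV" "\<Omega> \<noteq> {}"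
    and r0: "0 < r0" and t: "0 \<le> t" and pos: "0 < measure_density_index \<Omega> r0 t"
    and fin: "rel_capacity p (cball (0::'a) 1) (ball 0 2) < \<infinity>"
    and \<gamma>: "0 < \<gamma>"
      "\<gamma> < capacity_threshold TYPE('a) p (measure_density_index \<Omega> r0 t) t (ennreal r0 / inradius \<Omega>)"
  shows "capacitary_inradius p \<gamma> \<Omega> \<le> 6 * inradius \<Omega>"
proof (cases "inradius \<Omega> = \<infinity>")
  case False
  then obtain a where a: "inradius \<Omega> = ennreal a" "0 < a"
    using inradius_pos[OF \<Omega>(1,3)] by (cases "inradius \<Omega>") auto
  have "measure_density_index \<Omega> r0 t \<le> 1"
    by (rule measure_density_index_le_1) (use \<Omega> r0 in auto)
  then obtain \<theta> where \<theta>: "measure_density_index \<Omega> r0 t = ennreal \<theta>" "0 \<le> \<theta>" "\<theta> \<le> 1"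
    by (cases "measure_density_index \<Omega> r0 t") (auto simp: top_unique)
  have \<theta>_pos: "0 < \<theta>" using pos \<theta> by simp
  have \<kappa>: "ennreal r0 / inradius \<Omega> = ennreal (r0 / a)"
    using a r0 by (simp add: divide_ennreal)
  have "0 < density_factor DIM('a) \<theta> t (r0 / a)"
    unfolding density_factor_def using \<theta>_pos r0 a
    by (intro mult_pos_pos zero_less_power) (auto simp: min_def)
  then have "0 < threshold_ratio TYPE('a) p \<theta> t (r0 / a)"
    unfolding threshold_ratio_def
    by (intro divide_pos_pos mult_pos_pos add_pos_nonneg) auto
  then have \<gamma>_less: "\<gamma> < threshold_ratio TYPE('a) p \<theta> t (r0 / a)"
    using \<gamma>(2) \<theta>(2) r0 a unfolding \<theta>(1) \<kappa>
    by (simp add: capacity_threshold_def)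
  show ?thesis
    unfolding capacitary_inradius_def
  proof (rule Sup_least, clarify)
    fix r :: real and x0
    assume "0 < r" and cap: "rel_capacity p (closure (ball x0 r) - \<Omega>) (ball x0 (2 * r))
              \<le> ennreal \<gamma> * rel_capacity p (closure (ball x0 r)) (ball x0 (2 * r))"
    have "\<not> 6 * a < r"
      using threshold_ratio_le[OF p \<Omega>(1) \<theta>(2,3) _ r0 t a _ \<gamma>(1) fin cap] \<theta>(1) \<gamma>_less by force
    then have "ennreal r \<le> ennreal (6 * a)" by (intro ennreal_leI) simp
    then show "ennreal r \<le> 6 * inradius \<Omega>"
      using a by (simp add: ennreal_mult)
  qed
qed (simp add: ennreal_mult_top)

theorem theorem5p2:
  assumes "2 \<le> CARD('n::finite)"
  shows "\<exists>\<gamma>0 :: real \<Rightarrow> ennreal \<Rightarrow> real \<Rightarrow> ennreal \<Rightarrow> real.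
    \<forall>(p::real) (\<Omega>::(real^'n) set) (r0::real) (t::real).
      1 \<le> p \<and> p \<le> real CARD('n) \<and> open \<Omega> \<and> \<Omega> \<noteq> UNIV \<and> r0 > 0 \<and> t \<ge> 0 \<and>
      measure_density_index \<Omega> r0 t > 0 \<longrightarrow>
      (let g0 = \<gamma>0 p (measure_density_index \<Omega> r0 t) t (ennreal r0 / inradius \<Omega>)
       in 0 < g0 \<and> g0 < 1 \<and>
          (\<forall>\<sigma> C. two_sided_estimate_constants TYPE(real^'n) \<sigma> C \<longrightarrow>
            (\<forall>\<gamma>. 0 < \<gamma> \<and> \<gamma> < 1 \<longrightarrow>
              (let K = (if \<gamma> < g0 then 6 * sqrt (real CARD('n))
                        else 6 * sqrt (real CARD('n)) *
                               (2 * C p \<gamma> / (g0 * \<sigma> p)) powr (1 / p))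
               in inradius \<Omega> \<le> capacitary_inradius p \<gamma> \<Omega> \<and>
                  capacitary_inradius p \<gamma> \<Omega> \<le> ennreal K * inradius \<Omega>))))"
proof (rule exI[of _ "capacity_threshold TYPE(real^'n)"], intro allI impI)
  fix p r0 t :: real and \<Omega> :: "(real^'n) set"
  assume asm: "1 \<le> p \<and> p \<le> real CARD('n) \<and> open \<Omega> \<and> \<Omega> \<noteq> UNIV \<and> r0 > 0 \<and> t \<ge> 0 \<and>
      measure_density_index \<Omega> r0 t > 0"
  define g0 where "g0 = capacity_threshold TYPE(real^'n) p (measure_density_index \<Omega> r0 t) t
      (ennreal r0 / inradius \<Omega>)"
  have p: "1 \<le> p" "p \<le> real DIM(real^'n)" using asm by simp_all
  have g0: "0 < g0" "g0 < 1" by (simp_all add: g0_def capacity_threshold_bounds)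
  define S where "S = 6 * sqrt (real CARD('n))"
  have S: "6 \<le> S" using assms by (simp add: S_def)
  have upper: "capacitary_inradius p \<gamma> \<Omega> \<le> ennreal (if \<gamma> < g0 then S
      else S * (2 * C p \<gamma> / (g0 * \<sigma> p)) powr (1 / p)) * inradius \<Omega>"
    if est: "two_sided_estimate_constants TYPE(real^'n) \<sigma> C" and \<gamma>: "0 < \<gamma>" "\<gamma> < 1" for \<sigma> C \<gamma>
  proof (cases "\<Omega> = {}")
    case True
    then show ?thesis using capacitary_inradius_empty[OF est p \<gamma>] by simp
  next
    case False
    have small: "capacitary_inradius p \<gamma>' \<Omega> \<le> ennreal S * inradius \<Omega>" if "0 < \<gamma>'" "\<gamma>' < g0" for \<gamma>'
    proof -
      have "capacitary_inradius p \<gamma>' \<Omega> \<le> 6 * inradius \<Omega>"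
        by (rule capacitary_inradius_le_6_inradius[of p \<Omega> r0 t])
          (use asm False that rel_capacity_unit_ball_finite[OF est p] in \<open>auto simp: g0_def\<close>)
      also have "\<dots> \<le> ennreal S * inradius \<Omega>"
        using ennreal_leI[OF S] by (intro mult_right_mono) auto
      finally show ?thesis .
    qed
    show ?thesis
    proof (cases "\<gamma> < g0")
      case True
      then show ?thesis using small \<gamma> by simp
    next
      case large: False
      \<comment> \<open>Any parameter below the threshold would serve for the comparison; one half of it gives the
        factor \<open>2\<close> in the constant.\<close>
      have "capacitary_inradius p \<gamma> \<Omega>
          \<le> ennreal ((C p \<gamma> / (\<sigma> p * (g0 / 2))) powr (1 / p)) * capacitary_inradius p (g0 / 2) \<Omega>"
        using asm g0 by (intro capacitary_inradius_comparison[OF est p _ \<gamma>]) auto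
      also have "\<dots> \<le> ennreal ((C p \<gamma> / (\<sigma> p * (g0 / 2))) powr (1 / p)) * (ennreal S * inradius \<Omega>)"
        using g0 by (intro mult_left_mono small) auto
      also have "\<dots> = ennreal (S * (2 * C p \<gamma> / (g0 * \<sigma> p)) powr (1 / p)) * inradius \<Omega>"
        using S by (simp add: ennreal_mult mult_ac)
      finally show ?thesis using large by simp
    qed
  qed
  show "let g0 = capacity_threshold TYPE(real^'n) p (measure_density_index \<Omega> r0 t) t (ennreal r0 / inradius \<Omega>)
       in 0 < g0 \<and> g0 < 1 \<and>
          (\<forall>\<sigma> C. two_sided_estimate_constants TYPE(real^'n) \<sigma> C \<longrightarrow>
            (\<forall>\<gamma>. 0 < \<gamma> \<and> \<gamma> < 1 \<longrightarrow>
              (let K = (if \<gamma> < g0 then 6 * sqrt (real CARD('n))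
                        else 6 * sqrt (real CARD('n)) *
                               (2 * C p \<gamma> / (g0 * \<sigma> p)) powr (1 / p))
               in inradius \<Omega> \<le> capacitary_inradius p \<gamma> \<Omega> \<and>
                  capacitary_inradius p \<gamma> \<Omega> \<le> ennreal K * inradius \<Omega>)))"
    unfolding Let_def g0_def[symmetric] S_def[symmetric]
    using g0 inradius_le_capacitary_inradius upper by blast
qed

end
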